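(* Let $\ell\ge 2$ be an integer, let $F$ be a probability distribution on $\mathbb{R}$ with finite variance, let $W\sim F$, and let $A\subseteq\mathbb{R}$ be a Borel set with $\mathbb{P}(W\in A)=\ell^{-1}$. Let $G$ be a finite simple graph with $n\geq 1$ edges and girth at least $4$, and let $X_1,\dots,X_n$ be the random variables obtained from $G$, $\ell$, $F$, $A$ by the edge construction described in the context. Then $X_k\sim F$ for every $k\in\{1,\dots,n\}$, and the sequence $X_1,\dots,X_n$ is triplewise independent, i.e. for all pairwise distinct $k,k',k''\in\{1,\dots,n\}$ the random variables $X_k,X_{k'},X_{k''}$ are mutually independent.
   Context: Girth of a simple graph: the length of its shortest cycle ($+\infty$ if there is no cycle); girth at least $4$ means the graph has no triangle. Edge construction. Let $v$ be the number of vertices of $G$, labelled $1,\dots,v$. Let $M_1,\dots,M_v$ be i.i.d. uniform on $\{1,2,\dots,\ell\}$, with $M_i$ assigned to vertex $i$. For each edge $\{i,j\}$ of $G$ put $D_{i,j}=1$ if $M_i=M_j$ and $D_{i,j}=0$ otherwise. Enumerate the $n$ edges in some order and denote the corresponding variables by $D_1,\dots,D_n$. Let $F_U$ be the conditional law of $W$ given $\{W\in A^c\}$ and $F_V$ the conditional law of $W$ given $\{W\in A\}$. On the same probability space let $U_1,\dots,U_n$ be i.i.d. with law $F_U$ and $V_1,\dots,V_n$ i.i.d. with law $F_V$, such that the families $(U_k)_k$, $(V_k)_k$ and $(M_j)_j$ are mutually independent. Finally define, for $k=1,\dots,n$, $X_k=U_k$ on $\{D_k=0\}$ and $X_k=V_k$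 on $\{D_k=1\}$. *)

theory Defs
  imports "HOL-Probability.Probability"
begin

definition simple_graph :: "'v set \<Rightarrow> 'v set set \<Rightarrow> bool" where
  "simple_graph Vs Es \<longleftrightarrow> finite Vs \<and> (\<forall>e\<in>Es. e \<subseteq> Vs \<and> card e = 2)"

text \<open>
  A cycle is the list of its distinct vertices, starting anywhere and without repeating the
  first vertex at the end, so the length of the list is the number of edges of the cycle.
\<close>

definition graph_cycle :: "'v set set \<Rightarrow> 'v list \<Rightarrow> bool" where
  "graph_cycle Es c \<longleftrightarrow> length c \<ge> 3 \<and> distinct c \<and>
     (\<forall>i<length c. {c ! i, c ! (Suc i mod length c)} \<in> Es)"

text \<open>The infimum of the empty set in \<^typ>\<open>enat\<close> is \<open>\<infinity>\<close>, as required for acyclic graphs.\<close>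

definition girth :: "'v set set \<Rightarrow> enat" where
  "girth Es = (INF c\<in>{c. graph_cycle Es c}. enat (length c))"

definition finite_variance :: "real measure \<Rightarrow> bool" where
  "finite_variance F \<longleftrightarrow>
     integrable F (\<lambda>x. x) \<and> integrable F (\<lambda>x. (x - (\<integral>y. y \<partial>F))\<^sup>2)"

definition cond_law :: "'w measure \<Rightarrow> ('w \<Rightarrow> real) \<Rightarrow> real set \<Rightarrow> real measure" where
  "cond_law N W B = distr (uniform_measure N {w \<in> space N. W w \<in> B}) borel W"

definition family_sigma ::
  "'o measure \<Rightarrow> 'b measure \<Rightarrow> ('i \<Rightarrow> 'o \<Rightarrow> 'b) \<Rightarrow> 'i set \<Rightarrow> 'o set set" where
  "family_sigma P S Y I =
     sigma_sets (space P) (\<Union>i\<in>I. {Y i -` B \<inter> space P | B. B \<in> sets S})"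

definition edge_indicator :: "('v \<Rightarrow> 'o \<Rightarrow> nat) \<Rightarrow> 'v set \<Rightarrow> 'o \<Rightarrow> nat" where
  "edge_indicator M e \<omega> = (if \<exists>i j. e = {i, j} \<and> i \<noteq> j \<and> M i \<omega> = M j \<omega> then 1 else 0)"

definition edge_X ::
  "('v \<Rightarrow> 'o \<Rightarrow> nat) \<Rightarrow> (nat \<Rightarrow> 'v set) \<Rightarrow> (nat \<Rightarrow> 'o \<Rightarrow> real) \<Rightarrow> (nat \<Rightarrow> 'o \<Rightarrow> real)
     \<Rightarrow> nat \<Rightarrow> 'o \<Rightarrow> real" where
  "edge_X M edge U V k \<omega> = (if edge_indicator M (edge k) \<omega> = 0 then U k \<omega> else V k \<omega>)"

end

theory Submission
  imports Defs
begin

text \<open>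
  At most three edges of a triangle-free graph always include one with an endpoint \<open>v\<close> that lies
  on none of the others. Since \<open>M\<^sub>v\<close> is uniform and independent of the other labels, this edge is
  monochromatic with probability \<open>1/l\<close>, independently of the other edges. Removing such edges one
  at a time shows that the indicators \<open>D\<^sub>k\<close> of up to three edges are independent. Each \<open>X\<^sub>k\<close> is a
  function of \<open>(U\<^sub>k, V\<^sub>k, D\<^sub>k)\<close>, and these triples are then independent as well. The law of \<open>X\<^sub>k\<close> is
  the mixture of the two conditional laws with weights \<open>1 - 1/l\<close> and \<open>1/l\<close>, which is \<open>F\<close>.
\<close>

section \<open>Edge indicators and their events\<close>

lemma edge_indicator_doubleton:
  assumes "i \<noteq> j"
  shows "edge_indicator M {i, j} \<omega> = (if M i \<omega> = M j \<omega> then 1 else 0)"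
  using assms unfolding edge_indicator_def by (auto simp: doubleton_eq_iff)

text \<open>The indicator only takes the values 0 and 1, so a single event and its complement
  describe every preimage. Measurability in any sigma-algebra thus reduces to the event
  \<open>edge_indicator M e \<omega> = 1\<close>.\<close>

lemma edge_indicator_vimage:
  "edge_indicator M e -` B \<inter> S =
    (if 1 \<in> B then {\<omega> \<in> S. edge_indicator M e \<omega> = 1} else {}) \<union>
    (if 0 \<in> B then S - {\<omega> \<in> S. edge_indicator M e \<omega> = 1} else {})"
proof (rule set_eqI)
  fix \<omega>
  have "edge_indicator M e \<omega> = 0 \<or> edge_indicator M e \<omega> = 1"
    by (simp add: edge_indicator_def)
  then show "\<omega> \<in> edge_indicator M e -` B \<inter> S \<longleftrightarrow> \<omega> \<in>
      (if 1 \<in> B then {\<omega> \<in> S. edge_indicator M e \<omega> = 1} else {}) \<union>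
      (if 0 \<in> B then S - {\<omega> \<in> S. edge_indicator M e \<omega> = 1} else {})"
    by (elim disjE) auto
qed

text \<open>Two labels agree iff both equal some common \<open>r\<close>, which is a countable
  union. The sigma-algebra is left abstract because the fact serves twice: for all events of the
  space, and for the smaller sigma-algebra generated by the labels.\<close>

lemma edge_indicator_event:
  assumes "sigma_algebra \<Omega> \<A>" "i \<noteq> j"
    and Z: "\<And>r. Z i -` {r} \<inter> \<Omega> \<in> \<A>" "\<And>r. Z j -` {r} \<inter> \<Omega> \<in> \<A>"
  shows "{\<omega> \<in> \<Omega>. edge_indicator Z {i, j} \<omega> = 1} \<in> \<A>"
proof -
  interpret sigma_algebra \<Omega> \<A> by fact
  have "{\<omega> \<in> \<Omega>. edge_indicator Z {i, j} \<omega> = 1} = (\<Union>r. (Z i -` {r} \<inter> \<Omega>) \<inter> (Z j -` {r} \<inter> \<Omega>))"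
    using assms(2) by (auto simp: edge_indicator_doubleton)
  also have "\<dots> \<in> \<A>"
    using Int[OF Z] by (intro countable_UN image_subsetI)
  finally show ?thesis .
qed

section \<open>Triangle-free graphs and private endpoints\<close>

lemma simple_graph_edge:
  assumes "simple_graph Vs Es" "e \<in> Es"
  shows "\<exists>i\<in>Vs. \<exists>j\<in>Vs. e = {i, j} \<and> i \<noteq> j"
  using assms unfolding simple_graph_def card_2_iff by fastforce

lemma girth_ge_4_no_triangle:
  assumes "girth Es \<ge> 4" "{a, b} \<in> Es" "{b, c} \<in> Es" "{a, c} \<in> Es"
    and "distinct [a, b, c]"
  shows False
proof -
  have "graph_cycle Es [a, b, c]"
    unfolding graph_cycle_def
  proof (intro conjI allI impI)
    fix i assume "i < length [a, b, c]"
    then have "i = 0 \<or> i = 1 \<or> i = 2" by auto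
    \<comment> \<open>At \<open>i = 2\<close> the successor wraps around to 0, so the closing edge
      appears as \<open>{c, a}\<close>.\<close>
    then show "{[a, b, c] ! i, [a, b, c] ! (Suc i mod length [a, b, c])} \<in> Es"
      using assms(2-4) by (elim disjE) (simp_all add: insert_commute[of c a])
  qed (use assms(5) in simp_all)
  then have "girth Es \<le> enat (length [a, b, c])"
    unfolding girth_def by (intro INF_lower) simp
  also have "\<dots> = enat 3"
    by simp
  finally have "(4::enat) \<le> enat 3"
    using assms(1) by (rule order_trans[rotated])
  then show False
    by (simp add: numeral_eq_enat)
qed

text \<open>Otherwise every endpoint of an edge of \<open>L\<close> lies on a second edge of
  \<open>L\<close>. Extending an edge \<open>{a, b}\<close> at both ends yields
  \<open>{a, c}\<close> and \<open>{b, d}\<close>, which exhausts \<open>L\<close>; a second edge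
  through \<open>c\<close> then forces \<open>c = d\<close>, and \<open>a, b, c\<close> is a
  triangle.\<close>

lemma few_edges_leaf_exists:
  assumes G: "simple_graph Vs Es" "girth Es \<ge> 4"
    and L: "L \<subseteq> Es" "L \<noteq> {}" "finite L" "card L \<le> 3"
  obtains u v where "{u, v} \<in> L" "u \<noteq> v" "u \<in> Vs" "v \<in> Vs" "\<And>e. e \<in> L - {{u, v}} \<Longrightarrow> v \<notin> e"
proof -
  have "\<exists>u v. {u, v} \<in> L \<and> u \<noteq> v \<and> (\<forall>e \<in> L - {{u, v}}. v \<notin> e)"
  proof (rule ccontr)
    assume "\<not> ?thesis"
    then have nl: "\<exists>e \<in> L. e \<noteq> {u, v} \<and> v \<in> e" if "{u, v} \<in> L" "u \<noteq> v" for u v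
      using that by blast
    have edge: "\<exists>y. e = {x, y} \<and> x \<noteq> y" if ex: "e \<in> L" "x \<in> e" for e x
    proof -
      have "e \<in> Es" using ex L(1) by auto
      from simple_graph_edge[OF G(1) this] obtain i j where "e = {i, j}" "i \<noteq> j"
        by blast
      with ex(2) show ?thesis
        by (cases "x = i") (auto simp: insert_commute[of i j])
    qed
    obtain e where e: "e \<in> L" using L(2) by blast
    then have "e \<in> Es" using L(1) by auto
    from simple_graph_edge[OF G(1) this] obtain a b where "e = {a, b}" and "a \<noteq> b"
      by blast
    with e have ab: "{a, b} \<in> L" "{b, a} \<in> L" "a \<noteq> b"
      by (simp_all add: insert_commute[of b a])
    obtain e' where e': "e' \<in> L" "e' \<noteq> {b, a}" "a \<in> e'"
      using nl[of b a] ab by blast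
    obtain c where c: "{a, c} \<in> L" "a \<noteq> c" "c \<noteq> b"
      using edge[OF e'(1,3)] e' by blast
    obtain e'' where e'': "e'' \<in> L" "e'' \<noteq> {a, b}" "b \<in> e''"
      using nl[of a b] ab by blast
    obtain d where d: "{b, d} \<in> L" "b \<noteq> d" "d \<noteq> a"
      using edge[OF e''(1,3)] e'' by blast
    have "{a, b} \<noteq> {a, c}" "{a, b} \<noteq> {b, d}" "{a, c} \<noteq> {b, d}"
      using ab(3) c(2,3) d(2,3) by (simp_all add: doubleton_eq_iff)
    then have "card {{a, b}, {a, c}, {b, d}} = 3"
      by simp
    \<comment> \<open>Three distinct members already use up the bound
      \<open>card L \<le> 3\<close>.\<close>
    then have L_eq: "L = {{a, b}, {a, c}, {b, d}}"
      using card_seteq[OF L(3), of "{{a, b}, {a, c}, {b, d}}"] ab(1) c(1) d(1) L(4) by simp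
    have "c = d"
    proof -
      \<comment> \<open>A second edge through \<open>c\<close> cannot be \<open>{a, b}\<close>, as
        \<open>c\<close> differs from both ends; so it is \<open>{b, d}\<close>, and
        \<open>c \<noteq> b\<close> leaves \<open>c = d\<close>.\<close>
      obtain f where f: "f \<in> L" "f \<noteq> {a, c}" "c \<in> f"
        using nl[OF c(1,2)] by blast
      then have "f = {a, b} \<or> f = {b, d}"
        unfolding L_eq by blast
      with f(3) c(2,3) show ?thesis
        by (elim disjE) simp_all
    qed
    then show False
      using girth_ge_4_no_triangle[OF G(2), of a b c] ab(1,3) c d(1) L(1) by (simp add: subset_iff)
  qed
  then obtain u v where uv: "{u, v} \<in> L" "u \<noteq> v" "\<forall>e \<in> L - {{u, v}}. v \<notin> e"
    by blast
  have "{u, v} \<in> Es"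
    using uv(1) L(1) by auto
  then have "{u, v} \<subseteq> Vs"
    using G(1) by (simp only: simple_graph_def)
  then have "u \<in> Vs" "v \<in> Vs"
    by simp_all
  with uv show thesis
    by (intro that[of u v]) simp_all
qed

section \<open>Independence of labels, edge indicators and samples\<close>

context prob_space
begin

text \<open>Split by the value \<open>r\<close> of \<open>X v\<close>. As \<open>X v\<close> is
  independent of the other coordinates, \<open>u\<close> included, each \<open>r\<close> contributes
  the probability that \<open>X u = r\<close> and the rest lies in \<open>B\<close>, divided by
  \<open>card R\<close>; summing over \<open>r\<close> removes the constraint on
  \<open>X u\<close>.\<close>

lemma prob_eq_uniform_Int:
  fixes X :: "'i \<Rightarrow> 'a \<Rightarrow> 'b :: countable"
  assumes ind: "indep_vars (\<lambda>_. count_space UNIV) X I"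
    and uv: "u \<in> I" "v \<in> I" "u \<noteq> v"
    and R: "finite R" "R \<noteq> {}"
    and Xv: "distr M (count_space UNIV) (X v) = measure_pmf (pmf_of_set R)"
    and Xu: "AE \<omega> in M. X u \<omega> \<in> R"
    and B: "B \<in> sets (PiM (I - {v}) (\<lambda>_. count_space UNIV))"
  shows "prob {\<omega> \<in> space M. X u \<omega> = X v \<omega> \<and> restrict (\<lambda>i. X i \<omega>) (I - {v}) \<in> B} =
    prob {\<omega> \<in> space M. restrict (\<lambda>i. X i \<omega>) (I - {v}) \<in> B} / card R"
proof -
  let ?S = "PiM (I - {v}) (\<lambda>_. count_space UNIV :: 'b measure)"
  let ?Y = "\<lambda>\<omega>. restrict (\<lambda>i. X i \<omega>) (I - {v})"
  have X: "X i \<in> measurable M (count_space UNIV)" if "i \<in> I" for i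
    using that ind by (auto simp: indep_vars_def)
  have Y: "?Y \<in> measurable M ?S"
    using X by (intro measurable_restrict) auto
  \<comment> \<open>The constraint \<open>X u = r\<close> is absorbed into a measurable set of the
    coordinates other than \<open>v\<close>, so that independence of the two coordinate blocks
    \<open>I - {v}\<close> and \<open>{v}\<close> applies.\<close>
  let ?C = "\<lambda>r. {f \<in> space ?S. f u = r} \<inter> B"
  let ?E = "\<lambda>r. ?Y -` ?C r \<inter> space M"
  have C: "?C r \<in> sets ?S" for r
    using measurable_sets[OF measurable_component_singleton[of u "I - {v}" "\<lambda>_. count_space UNIV"], of "{r}"] uv B
    by (intro sets.Int) (auto simp: vimage_def Int_def conj_commute)
  have E: "?E r \<in> events" for r
    using measurable_sets[OF Y C] .
  have Z: "{f \<in> space (PiM {v} (\<lambda>_. count_space UNIV :: 'b measure)). f v = r}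
      \<in> sets (PiM {v} (\<lambda>_. count_space UNIV))" for r
    using measurable_sets[OF measurable_component_singleton[of v "{v}" "\<lambda>_. count_space UNIV"], of "{r}"]
    by (auto simp: vimage_def Int_def conj_commute)
  have Zv: "X v -` {r} \<inter> space M \<in> events" for r
    using X[OF uv(2)] by auto
  have Xr: "prob (X v -` {r} \<inter> space M) = 1 / card R" if "r \<in> R" for r
    using that R measure_distr[OF X[OF uv(2)], of "{r}"]
    by (simp add: Xv measure_pmf_single)
  have indep: "prob (?E r \<inter> (X v -` {r} \<inter> space M)) = prob (?E r) * prob (X v -` {r} \<inter> space M)" for r
  proof -
    let ?D = "{f \<in> space (PiM {v} (\<lambda>_. count_space UNIV :: 'b measure)). f v = r}"
    let ?Z = "\<lambda>\<omega>. restrict (\<lambda>i. X i \<omega>) {v}"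
    have "X v -` {r} \<inter> space M = ?Z -` ?D \<inter> space M"
      by (auto simp: space_PiM)
    moreover have "prob ((\<lambda>\<omega>. (?Y \<omega>, ?Z \<omega>)) -` (?C r \<times> ?D) \<inter> space M) =
        prob (?Y -` ?C r \<inter> space M) * prob (?Z -` ?D \<inter> space M)"
      using uv by (intro indep_varD[OF indep_var_restrict[OF ind]] C Z) auto
    moreover have "(\<lambda>\<omega>. (?Y \<omega>, ?Z \<omega>)) -` (?C r \<times> ?D) \<inter> space M = ?E r \<inter> (?Z -` ?D \<inter> space M)"
      by auto
    ultimately show ?thesis
      by simp
  qed
  have YS: "?Y \<omega> \<in> space ?S" for \<omega>
    by (simp add: space_PiM)
  have Yu: "?Y \<omega> u = X u \<omega>" for \<omega>
    using uv by simp
  have YB: "{\<omega> \<in> space M. ?Y \<omega> \<in> B} \<in> events"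
    using measurable_sets[OF Y B] by (simp add: vimage_def Int_def conj_commute)
  have YBeq: "{\<omega> \<in> space M. X u \<omega> = X v \<omega> \<and> ?Y \<omega> \<in> B} =
      (\<Union>r. ?E r \<inter> (X v -` {r} \<inter> space M))"
    using YS Yu by auto
  let ?G = "\<lambda>r. ?E r \<inter> (X v -` {r} \<inter> space M)"
  have G: "?G r \<in> events" for r
    using E Zv by (rule sets.Int)
  have "prob {\<omega> \<in> space M. X u \<omega> = X v \<omega> \<and> ?Y \<omega> \<in> B} = prob (\<Union>r\<in>R. ?G r)"
    unfolding YBeq
  proof (rule finite_measure_eq_AE)
    show "(\<Union>r. ?G r) \<in> events"
      using G by (intro sets.countable_UN'') auto
    show "(\<Union>r\<in>R. ?G r) \<in> events"
      using G R(1) by (intro sets.finite_UN)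
    have "\<omega> \<in> (\<Union>r. ?G r) \<longleftrightarrow> \<omega> \<in> (\<Union>r\<in>R. ?G r)" if "X u \<omega> \<in> R" for \<omega>
      using that by (simp add: Yu del: restrict_apply)
    with Xu show "AE \<omega> in M. \<omega> \<in> (\<Union>r. ?G r) \<longleftrightarrow> \<omega> \<in> (\<Union>r\<in>R. ?G r)"
      by (rule eventually_mono)
  qed
  also have "\<dots> = (\<Sum>r\<in>R. prob (?G r))"
  proof (rule finite_measure_finite_Union[OF R(1)])
    show "?G ` R \<subseteq> events"
      using G by (rule image_subsetI)
    show "disjoint_family_on ?G R"
      unfolding disjoint_family_on_def by blast
  qed
  also have "\<dots> = (\<Sum>r\<in>R. prob (?E r)) / card R"
    by (simp only: indep sum_divide_distrib) (intro sum.cong refl, simp add: Xr)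
  \<comment> \<open>With the factor of \<open>X v\<close> gone, the disjoint slices are glued
    together again over the values of \<open>X u\<close>.\<close>
  also have "(\<Sum>r\<in>R. prob (?E r)) = prob (\<Union>r\<in>R. ?E r)"
  proof (rule finite_measure_finite_Union[OF R(1), symmetric])
    show "?E ` R \<subseteq> events"
      using E by (rule image_subsetI)
    show "disjoint_family_on ?E R"
      unfolding disjoint_family_on_def by blast
  qed
  also have "\<dots> = prob {\<omega> \<in> space M. ?Y \<omega> \<in> B}"
  proof (rule finite_measure_eq_AE)
    show "(\<Union>r\<in>R. ?E r) \<in> events"
      using E R(1) by (intro sets.finite_UN)
    show "{\<omega> \<in> space M. ?Y \<omega> \<in> B} \<in> events"
      by (rule YB)
    have "\<omega> \<in> (\<Union>r\<in>R. ?E r) \<longleftrightarrow> \<omega> \<in> {\<omega> \<in> space M. ?Y \<omega> \<in> B}" if "X u \<omega> \<in> R" for \<omega>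
      using that YS by (auto simp: Yu simp del: restrict_apply)
    with Xu show "AE \<omega> in M. \<omega> \<in> (\<Union>r\<in>R. ?E r) \<longleftrightarrow> \<omega> \<in> {\<omega> \<in> space M. ?Y \<omega> \<in> B}"
      by (rule eventually_mono)
  qed
  finally show ?thesis .
qed

text \<open>Independence is associative: a finite intersection over \<open>K\<close> is grouped by
  first index, factored over the rows by \<open>out\<close>, then within each row by
  \<open>ins\<close>. The rows enter \<open>out\<close> through generated sigma-algebras since an
  intersection along a row need not be a member of any single \<open>F (t, k)\<close>.\<close>

lemma indep_sets_Sigma:
  assumes out: "indep_sets (\<lambda>t. sigma_sets (space M) (\<Union>k\<in>J t. F (t, k))) I"
    and ins: "\<And>t. t \<in> I \<Longrightarrow> indep_sets (\<lambda>k. F (t, k)) (J t)"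
  shows "indep_sets F (Sigma I J)"
proof (rule indep_setsI)
  show "F i \<subseteq> events" if "i \<in> Sigma I J" for i
    using that ins unfolding indep_sets_def by force
next
  fix A K assume K: "K \<noteq> {}" "K \<subseteq> Sigma I J" "finite K" "\<forall>j\<in>K. A j \<in> F j"
  let ?T = "fst ` K" and ?R = "\<lambda>t. {k. (t, k) \<in> K}"
  have fin: "finite (?R t)" for t
    using finite_imageI[OF K(3), of snd] by (rule rev_finite_subset) force
  have ne: "?R t \<noteq> {}" if "t \<in> ?T" for t
    using that by auto
  have KS: "K = Sigma ?T ?R"
    by force
  let ?B = "\<lambda>t. \<Inter>k\<in>?R t. A (t, k)"
  have B: "?B t \<in> sigma_sets (space M) (\<Union>k\<in>J t. F (t, k))" if t: "t \<in> ?T" for t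
  proof -
    have tI: "t \<in> I" using t K(2) by auto
    have "(\<Union>k\<in>J t. F (t, k)) \<subseteq> Pow (space M)"
      using ins[OF tI] sets.sets_into_space unfolding indep_sets_def by blast
    then interpret s: sigma_algebra "space M" "sigma_sets (space M) (\<Union>k\<in>J t. F (t, k))"
      by (rule sigma_algebra_sigma_sets)
    \<comment> \<open>Nonemptiness of the row matters: an empty intersection would be
      \<open>UNIV\<close> instead of \<open>space M\<close>.\<close>
    show ?thesis
      using K(2,4) fin ne[OF t] by (intro s.finite_INT) auto
  qed
  have "prob (\<Inter>j\<in>K. A j) = prob (\<Inter>t\<in>?T. ?B t)"
    by (intro arg_cong[where f = prob]) force
  also have "\<dots> = (\<Prod>t\<in>?T. prob (?B t))"
    using K B by (intro indep_setsD[OF out]) auto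
  also have "\<dots> = (\<Prod>t\<in>?T. \<Prod>k\<in>?R t. prob (A (t, k)))"
    using K fin ne by (intro prod.cong refl indep_setsD[OF ins]) auto
  also have "\<dots> = (\<Prod>j\<in>K. prob (A j))"
    using K(3) fin by (subst (3) KS, subst prod.Sigma) auto
  finally show "prob (\<Inter>j\<in>K. A j) = (\<Prod>j\<in>K. prob (A j))" .
qed

text \<open>Induction on \<open>card L\<close>: the edge with a private endpoint \<open>v\<close>
  splits off a factor \<open>1 / card R\<close>, and the bound of three edges is inherited by what
  remains.\<close>

lemma prob_few_edges_monochromatic:
  fixes Z :: "'v \<Rightarrow> 'a \<Rightarrow> nat"
  assumes G: "simple_graph Vs Es" "girth Es \<ge> 4" and L: "L \<subseteq> Es" "finite L" "card L \<le> 3"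
    and ind: "indep_vars (\<lambda>_. count_space UNIV) Z Vs"
    and R: "finite R" "R \<noteq> {}"
    and Z: "\<And>i. i \<in> Vs \<Longrightarrow> distr M (count_space UNIV) (Z i) = measure_pmf (pmf_of_set R)"
  shows "prob {\<omega> \<in> space M. \<forall>e\<in>L. edge_indicator Z e \<omega> = 1} = (1 / card R) ^ card L"
  using L
proof (induction "card L" arbitrary: L)
  case 0
  then show ?case by (simp add: prob_space)
next
  case (Suc m)
  then have "L \<noteq> {}" by auto
  obtain u v where uv: "{u, v} \<in> L" "u \<noteq> v" "u \<in> Vs" "v \<in> Vs"
    and leaf: "\<And>e. e \<in> L - {{u, v}} \<Longrightarrow> v \<notin> e"
    using few_edges_leaf_exists[OF G Suc.prems(1) \<open>L \<noteq> {}\<close> Suc.prems(2,3)] by blast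
  let ?L = "L - {{u, v}}" and ?S = "PiM (Vs - {v}) (\<lambda>_. count_space UNIV :: nat measure)"
  \<comment> \<open>The labelling \<open>f\<close> itself serves as sample point, with evaluation as
    the label variables. This turns the event for the remaining edges into a set of labellings of
    \<open>Vs - {v}\<close>.\<close>
  let ?B = "{f \<in> space ?S. \<forall>e\<in>?L. edge_indicator (\<lambda>i f. f i) e f = 1}"
  let ?Y = "\<lambda>\<omega>. restrict (\<lambda>i. Z i \<omega>) (Vs - {v})"
  have edge: "\<exists>i\<in>Vs - {v}. \<exists>j\<in>Vs - {v}. i \<noteq> j \<and> e = {i, j}" if "e \<in> ?L" for e
  proof -
    have "e \<in> Es" using that Suc.prems(1) by blast
    from simple_graph_edge[OF G(1) this] obtain i j where "i \<in> Vs" "j \<in> Vs" "e = {i, j}" "i \<noteq> j"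
      by blast
    with leaf[OF that] show ?thesis by (intro bexI[of _ i] bexI[of _ j]) auto
  qed
  have B: "?B \<in> sets ?S"
  proof (intro sets.sets_Collect_finite_All)
    fix e assume "e \<in> ?L"
    with edge obtain i j where ij: "i \<in> Vs - {v}" "j \<in> Vs - {v}" "i \<noteq> j" "e = {i, j}" by blast
    note [measurable] = measurable_component_singleton[OF ij(1), of "\<lambda>_. count_space UNIV :: nat measure"]
      measurable_component_singleton[OF ij(2), of "\<lambda>_. count_space UNIV :: nat measure"]
    have "{f \<in> space ?S. f i = f j} \<in> sets ?S"
      by measurable
    then show "{f \<in> space ?S. edge_indicator (\<lambda>i f. f i) e f = 1} \<in> sets ?S"
      using ij(3) by (simp add: ij(4) edge_indicator_doubleton)
  qed (use Suc.prems in auto)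
  have YB: "?Y \<omega> \<in> ?B \<longleftrightarrow> (\<forall>e\<in>?L. edge_indicator Z e \<omega> = 1)" for \<omega>
  proof -
    have "edge_indicator (\<lambda>i f. f i) e (?Y \<omega>) = edge_indicator Z e \<omega>" if e: "e \<in> ?L" for e
    proof -
      obtain i j where "i \<in> Vs - {v}" "j \<in> Vs - {v}" "i \<noteq> j" "e = {i, j}"
        using edge[OF e] by blast
      then show ?thesis
        by (simp add: edge_indicator_doubleton)
    qed
    then show ?thesis by (simp add: space_PiM)
  qed
  \<comment> \<open>Only the law of \<open>Z u\<close> is prescribed, so membership in
    \<open>R\<close> holds merely almost everywhere.\<close>
  have Zu: "AE \<omega> in M. Z u \<omega> \<in> R"
  proof -
    have "Z u \<in> measurable M (count_space UNIV)"
      using ind uv by (auto simp: indep_vars_def)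
    moreover have "AE x in distr M (count_space UNIV) (Z u). x \<in> R"
      unfolding Z[OF uv(3)] using R by (simp add: AE_measure_pmf_iff)
    ultimately show ?thesis
      by (simp add: AE_distr_iff)
  qed
  have c: "card ?L = m"
    using Suc uv by simp
  have "prob {\<omega> \<in> space M. \<forall>e\<in>L. edge_indicator Z e \<omega> = 1} =
      prob {\<omega> \<in> space M. Z u \<omega> = Z v \<omega> \<and> ?Y \<omega> \<in> ?B}"
    unfolding YB
  proof (intro arg_cong[where f = prob] Collect_cong conj_cong refl)
    fix \<omega>
    have "L = insert {u, v} ?L" using uv by auto
    then have "(\<forall>e\<in>L. edge_indicator Z e \<omega> = 1) \<longleftrightarrow>
        edge_indicator Z {u, v} \<omega> = 1 \<and> (\<forall>e\<in>?L. edge_indicator Z e \<omega> = 1)"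
      by (metis insert_iff)
    then show "(\<forall>e\<in>L. edge_indicator Z e \<omega> = 1) \<longleftrightarrow>
        Z u \<omega> = Z v \<omega> \<and> (\<forall>e\<in>?L. edge_indicator Z e \<omega> = 1)"
      using uv by (simp add: edge_indicator_doubleton)
  qed
  also have "\<dots> = prob {\<omega> \<in> space M. ?Y \<omega> \<in> ?B} / card R"
    by (rule prob_eq_uniform_Int[OF ind uv(3,4,2) R Z[OF uv(4)] Zu B])
  also have "{\<omega> \<in> space M. ?Y \<omega> \<in> ?B} = {\<omega> \<in> space M. \<forall>e\<in>?L. edge_indicator Z e \<omega> = 1}"
    unfolding YB ..
  also have "prob \<dots> = (1 / card R) ^ card ?L"
    using Suc c by (intro Suc.hyps(1)) auto
  finally show ?case
    using Suc.hyps(2) c by (simp flip: Suc.hyps(2))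
qed

text \<open>Every nonempty subset \<open>J\<close> of \<open>K\<close> gives the joint probability
  \<open>(1 / card R) ^ card J\<close>, which is the product of the singleton cases. Injectivity of
  \<open>edge\<close> makes the number of edges equal to the number of indices.\<close>

lemma indep_vars_edge_indicator:
  fixes Z :: "'v \<Rightarrow> 'a \<Rightarrow> nat"
  assumes G: "simple_graph Vs Es" "girth Es \<ge> 4"
    and K: "edge ` K \<subseteq> Es" "inj_on edge K" "finite K" "card K \<le> 3"
    and ind: "indep_vars (\<lambda>_. count_space UNIV) Z Vs"
    and R: "finite R" "R \<noteq> {}"
    and Z: "\<And>i. i \<in> Vs \<Longrightarrow> distr M (count_space UNIV) (Z i) = measure_pmf (pmf_of_set R)"
  shows "indep_vars (\<lambda>_. count_space UNIV) (\<lambda>k. edge_indicator Z (edge k)) K"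
proof -
  let ?D = "\<lambda>k. edge_indicator Z (edge k)"
  let ?E = "\<lambda>k. {\<omega> \<in> space M. ?D k \<omega> = 1}"
  have E: "?E k \<in> events" if k: "k \<in> K" for k
  proof -
    have "edge k \<in> Es"
      using K(1) k by auto
    from simple_graph_edge[OF G(1) this] obtain i j where ij: "edge k = {i, j}" "i \<noteq> j" "i \<in> Vs" "j \<in> Vs"
      by blast
    have ev: "Z x -` {r} \<inter> space M \<in> events" if "x \<in> Vs" for x r
      using that ind by (auto simp: indep_vars_def intro: measurable_sets)
    show ?thesis
      unfolding ij(1) by (intro edge_indicator_event sets.sigma_algebra_axioms ij ev)
  qed
  have pJ: "prob (\<Inter>k\<in>J. ?E k) = (1 / card R) ^ card J" if J: "J \<subseteq> K" "J \<noteq> {}" for J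
  proof -
    have "(\<Inter>k\<in>J. ?E k) = {\<omega> \<in> space M. \<forall>e\<in>edge ` J. edge_indicator Z e \<omega> = 1}"
      using J(2) by auto
    moreover have "card (edge ` J) = card J"
      using inj_on_subset[OF K(2) J(1)] by (rule card_image)
    moreover have "card J \<le> card K" "finite J"
      using card_mono[OF K(3) J(1)] finite_subset[OF J(1) K(3)] by auto
    moreover have "prob {\<omega> \<in> space M. \<forall>e\<in>edge ` J. edge_indicator Z e \<omega> = 1} =
        (1 / card R) ^ card (edge ` J)"
      using J K calculation by (intro prob_few_edges_monochromatic[OF G _ _ _ ind R Z]) auto
    ultimately show ?thesis
      by simp
  qed
  have "indep_sets (\<lambda>k. {?E k}) K"
  proof (rule indep_setsI)
    fix A J assume J: "J \<noteq> {}" "J \<subseteq> K" "finite J" "\<forall>j\<in>J. A j \<in> {?E j}"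
    have "prob (\<Inter>j\<in>J. A j) = prob (\<Inter>k\<in>J. ?E k)"
      using J(4) by (intro arg_cong[where f = prob] INF_cong) auto
    also have "\<dots> = (\<Prod>j\<in>J. 1 / card R)"
      using pJ[OF J(2,1)] by (simp only: prod_constant)
    also have "\<dots> = (\<Prod>j\<in>J. prob (A j))"
    proof (rule prod.cong)
      fix j assume "j \<in> J"
      with J pJ[of "{j}"] show "1 / card R = prob (A j)"
        by auto
    qed simp
    finally show "prob (\<Inter>j\<in>J. A j) = (\<Prod>j\<in>J. prob (A j))" .
  qed (use E in auto)
  \<comment> \<open>A family with a single event is stable under intersection, so independence
    passes to the generated sigma-algebra, which contains all preimages under
    \<open>?D k\<close>.\<close>
  then have "indep_sets (\<lambda>k. sigma_sets (space M) {?E k}) K"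
    by (rule indep_sets_sigma) (auto simp: Int_stable_def)
  moreover have sub: "{?D k -` B \<inter> space M |B. B \<in> sets (count_space UNIV)} \<subseteq> sigma_sets (space M) {?E k}" for k
  proof safe
    fix B :: "nat set"
    have "(if 1 \<in> B then S else {}) \<union> (if 0 \<in> B then space M - S else {})
        \<in> sigma_sets (space M) {S}" if "S \<subseteq> space M" for S
    proof -
      interpret s: sigma_algebra "space M" "sigma_sets (space M) {S}"
        using that by (intro sigma_algebra_sigma_sets) auto
      have "S \<in> sigma_sets (space M) {S}"
        by (rule sigma_sets.Basic) simp
      then show ?thesis
        by auto
    qed
    then show "?D k -` B \<inter> space M \<in> sigma_sets (space M) {?E k}"
      unfolding edge_indicator_vimage by this blast
  qed
  ultimately have "indep_sets (\<lambda>k. {?D k -` B \<inter> space M |B. B \<in> sets (count_space UNIV)}) K"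
    by (rule indep_sets_mono_sets)
  moreover have "random_variable (count_space UNIV) (?D k)" if "k \<in> K" for k
  proof (rule measurableI)
    have "sigma_sets (space M) {?E k} \<subseteq> events"
      using E[OF that] by (intro sets.sigma_sets_subset) auto
    with sub[of k] show "?D k -` B \<inter> space M \<in> events" for B
      by auto
  qed simp
  ultimately show ?thesis
    unfolding indep_vars_def2 by simp
qed

text \<open>The pair \<open>(t, k)\<close> selects the \<open>U\<close>, \<open>V\<close> or
  indicator variable of edge \<open>k\<close>; the indicator is cast to the reals so that all share
  one codomain. Rows are independent of each other by \<open>fam\<close> and within themselves by
  \<open>U\<close>, \<open>V\<close>, \<open>D\<close>, so \<open>indep_sets_Sigma\<close>
  applies.\<close>

lemma indep_vars_edge_data:
  fixes Z :: "'v \<Rightarrow> 'a \<Rightarrow> nat" and U V :: "nat \<Rightarrow> 'a \<Rightarrow> real"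
  assumes G: "simple_graph Vs Es" and K: "edge ` K \<subseteq> Es" "K \<subseteq> I"
    and Z: "\<And>i. i \<in> Vs \<Longrightarrow> random_variable (count_space UNIV) (Z i)"
    and D: "indep_vars (\<lambda>_. count_space UNIV) (\<lambda>k. edge_indicator Z (edge k)) K"
    and U: "indep_vars (\<lambda>_. borel) U I" and V: "indep_vars (\<lambda>_. borel) V I"
    and fam: "indep_sets (\<lambda>t. [family_sigma M borel U I, family_sigma M borel V I,
                 family_sigma M (count_space UNIV) Z Vs] ! t) {..<3::nat}"
  shows "indep_vars (\<lambda>_. borel)
    (\<lambda>(t, k). [U k, V k, \<lambda>\<omega>. real (edge_indicator Z (edge k) \<omega>)] ! t) ({..<3::nat} \<times> K)"
proof -
  let ?Y = "\<lambda>(t, k). [U k, V k, \<lambda>\<omega>. real (edge_indicator Z (edge k) \<omega>)] ! t"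
  let ?F = "\<lambda>i. {?Y i -` B \<inter> space M |B. B \<in> sets borel}"
  have three: "t = 0 \<or> t = 1 \<or> t = 2" if "t \<in> {..<3::nat}" for t
    using that by auto
  have ind: "indep_vars (\<lambda>_. borel) (\<lambda>k. ?Y (t, k)) K" if "t \<in> {..<3}" for t
  proof -
    have "indep_vars (\<lambda>_. borel) (\<lambda>k \<omega>. real (edge_indicator Z (edge k) \<omega>)) K"
      by (rule indep_vars_compose2[OF D]) simp
    then show ?thesis
      using three[OF that] indep_vars_subset[OF U K(2)] indep_vars_subset[OF V K(2)] by auto
  qed
  have gen: "(\<Union>k\<in>K. ?F (t, k)) \<subseteq> [family_sigma M borel U I, family_sigma M borel V I,
      family_sigma M (count_space UNIV) Z Vs] ! t" if t: "t \<in> {..<3}" for t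
  proof -
    consider "t = 0" | "t = 1" | "t = 2"
      using three[OF t] by blast
    then show ?thesis
    proof cases
      \<comment> \<open>This is the row \<open>t = 2\<close>: each edge indicator is determined by
        two labels, hence its events lie in the sigma-algebra of the label family.\<close>
      case 3
      let ?\<Sigma> = "family_sigma M (count_space UNIV) Z Vs"
      interpret s: sigma_algebra "space M" ?\<Sigma>
        unfolding family_sigma_def by (rule sigma_algebra_sigma_sets) auto
      have "?Y (2, k) -` B \<inter> space M \<in> ?\<Sigma>" if k: "k \<in> K" for k B
      proof -
        have "edge k \<in> Es"
          using K(1) k by auto
        from simple_graph_edge[OF G(1) this] obtain i j where ij: "edge k = {i, j}" "i \<noteq> j" "i \<in> Vs" "j \<in> Vs"
          by blast
        have Zr: "Z x -` {r} \<inter> space M \<in> ?\<Sigma>" if "x \<in> Vs" for x r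
          unfolding family_sigma_def using that by (intro sigma_sets.Basic) auto
        let ?S = "{\<omega> \<in> space M. edge_indicator Z (edge k) \<omega> = 1}"
        have S: "?S \<in> ?\<Sigma>"
          unfolding ij(1) by (intro edge_indicator_event s.sigma_algebra_axioms ij Zr)
        have "?Y (2, k) -` B \<inter> space M = edge_indicator Z (edge k) -` (real -` B) \<inter> space M"
          by auto
        also have "\<dots> \<in> ?\<Sigma>"
          unfolding edge_indicator_vimage using S by auto
        finally show ?thesis .
      qed
      with 3 show ?thesis by auto
    qed (use K in \<open>auto simp: family_sigma_def intro!: sigma_sets.Basic\<close>)
  qed
  have "indep_sets ?F (Sigma {..<3} (\<lambda>_. K))"
  proof (rule indep_sets_Sigma)
    show "indep_sets (\<lambda>t. sigma_sets (space M) (\<Union>k\<in>K. ?F (t, k))) {..<3}"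
    proof (rule indep_sets_mono_sets[OF fam])
      fix t :: nat assume t: "t \<in> {..<3}"
      \<comment> \<open>Each of the three families is itself of the form \<open>sigma_sets\<close>,
        so it contains what is generated by its own members.\<close>
      then obtain G' where G': "[family_sigma M borel U I, family_sigma M borel V I,
          family_sigma M (count_space UNIV) Z Vs] ! t = sigma_sets (space M) G'"
        using three[OF t] unfolding family_sigma_def by (elim disjE) simp_all
      show "sigma_sets (space M) (\<Union>k\<in>K. ?F (t, k)) \<subseteq> [family_sigma M borel U I,
          family_sigma M borel V I, family_sigma M (count_space UNIV) Z Vs] ! t"
        using gen[OF t] unfolding G' by (rule sigma_sets_mono)
    qed
    show "indep_sets (\<lambda>k. ?F (t, k)) K" if "t \<in> {..<3}" for t
      using ind[OF that] unfolding indep_vars_def2 by blast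
  qed
  moreover have "random_variable borel (?Y i)" if "i \<in> {..<3} \<times> K" for i
    using that ind[of "fst i"] unfolding indep_vars_def2 by (cases i) simp
  ultimately show ?thesis
    unfolding indep_vars_def2 by blast
qed

end

section \<open>Mixture of conditional laws and the edge variables\<close>

lemma cond_law_mixture:
  assumes N: "prob_space N" and W: "W \<in> borel_measurable N" and A: "A \<in> sets borel" and B: "B \<in> sets borel"
    and p: "measure N {w \<in> space N. W w \<in> A} = p" "0 < p" "p < 1"
  shows "(1 - p) * measure (cond_law N W (- A)) B + p * measure (cond_law N W A) B =
    measure (distr N borel W) B"
proof -
  interpret N: prob_space N by fact
  let ?E = "\<lambda>C. {w \<in> space N. W w \<in> C}"
  have E: "?E C \<in> N.events" if "C \<in> sets borel" for C
    using measurable_sets[OF W that] by (simp add: vimage_def Int_def conj_commute)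
  have cond: "measure (cond_law N W C) B = measure N (?E C \<inter> ?E B) / measure N (?E C)"
    if C: "C \<in> sets borel" and pos: "measure N (?E C) > 0" for C
  proof -
    have "measure (cond_law N W C) B = measure (uniform_measure N (?E C)) (W -` B \<inter> space N)"
      unfolding cond_law_def using W B by (subst measure_distr) (auto simp: measurable_def)
    also have "W -` B \<inter> space N = ?E B" by auto
    finally show ?thesis
      using pos E[OF C] E[OF B] by (simp add: measure_uniform_measure N.emeasure_eq_measure)
  qed
  have "?E (- A) = space N - ?E A" by auto
  then have q: "measure N (?E (- A)) = 1 - p"
    using N.prob_compl[OF E[OF A]] p by simp
  \<comment> \<open>Law of total probability. Since \<open>0 < p < 1\<close>, both conditioning
    events have positive probability, and the weights cancel the denominators in
    \<open>cond\<close>.\<close>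
  have "measure N (?E (- A) \<inter> ?E B) + measure N (?E A \<inter> ?E B) =
      measure N ((?E (- A) \<inter> ?E B) \<union> (?E A \<inter> ?E B))"
    using E A B by (intro N.finite_measure_Union[symmetric] sets.Int) auto
  also have "(?E (- A) \<inter> ?E B) \<union> (?E A \<inter> ?E B) = W -` B \<inter> space N" by auto
  also have "measure N \<dots> = measure (distr N borel W) B"
    using W B by (simp add: measure_distr)
  finally show ?thesis
    using p q cond[OF A] cond[of "- A"] A by (simp add: borel_comp)
qed

theorem mainTheorem1:
  fixes l n :: nat
    and F :: "real measure" and N :: "'w measure" and W :: "'w \<Rightarrow> real" and A :: "real set"
    and Vs :: "'v set" and Es :: "'v set set" and edge :: "nat \<Rightarrow> 'v set"
    and P :: "'o measure" and M :: "'v \<Rightarrow> 'o \<Rightarrow> nat" and U V :: "nat \<Rightarrow> 'o \<Rightarrow> real"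
  assumes "l \<ge> 2"
    and "prob_space N" and "W \<in> borel_measurable N" and "distr N borel W = F"
    and "finite_variance F"
    and "A \<in> sets borel" and "measure N {w \<in> space N. W w \<in> A} = 1 / real l"
    and "simple_graph Vs Es" and "card Es = n" and "n \<ge> 1" and "girth Es \<ge> 4"
    and "bij_betw edge {1..n} Es"
    and "prob_space P"
    and "prob_space.indep_vars P (\<lambda>_. count_space UNIV) M Vs"
    and "\<And>i. i \<in> Vs \<Longrightarrow> distr P (count_space UNIV) (M i) = measure_pmf (pmf_of_set {1..l})"
    and "prob_space.indep_vars P (\<lambda>_. borel) U {1..n}"
    and "\<And>k. k \<in> {1..n} \<Longrightarrow> distr P borel (U k) = cond_law N W (- A)"
    and "prob_space.indep_vars P (\<lambda>_. borel) V {1..n}"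
    and "\<And>k. k \<in> {1..n} \<Longrightarrow> distr P borel (V k) = cond_law N W A"
    and "prob_space.indep_sets P
           (\<lambda>t. [family_sigma P borel U {1..n}, family_sigma P borel V {1..n},
                 family_sigma P (count_space UNIV) M Vs] ! t) {..<3::nat}"
  shows "(\<forall>k\<in>{1..n}. edge_X M edge U V k \<in> borel_measurable P \<and>
                      distr P borel (edge_X M edge U V k) = F) \<and>
         (\<forall>k\<in>{1..n}. \<forall>k'\<in>{1..n}. \<forall>k''\<in>{1..n}. k \<noteq> k' \<and> k \<noteq> k'' \<and> k' \<noteq> k'' \<longrightarrow>
            prob_space.indep_vars P (\<lambda>_. borel) (edge_X M edge U V) {k, k', k''})"
proof -
  interpret N: prob_space N by fact
  interpret P: prob_space P by fact
  have R: "finite {1..l}" "{1..l} \<noteq> {}"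
    using assms(1) by auto
  have M: "M i \<in> measurable P (count_space UNIV)" if "i \<in> Vs" for i
    using that assms(14) by (auto simp: P.indep_vars_def)
  have bij: "edge ` {1..n} = Es" "inj_on edge {1..n}"
    using assms(12) by (auto simp: bij_betw_def)
  let ?D = "\<lambda>k. edge_indicator M (edge k)"
  let ?Y = "\<lambda>(t, k). [U k, V k, \<lambda>\<omega>. real (?D k \<omega>)] ! t"
  have data: "P.indep_vars (\<lambda>_. borel) ?Y ({..<3::nat} \<times> K)" if K: "K \<subseteq> {1..n}" "card K \<le> 3" for K
  proof -
    have "P.indep_vars (\<lambda>_. count_space UNIV) ?D K"
      using K bij assms(15) finite_subset[OF K(1)] inj_on_subset[OF bij(2) K(1)]
      by (intro P.indep_vars_edge_indicator[OF assms(8,11) _ _ _ _ assms(14) R]) auto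
    then show ?thesis
      using K bij M by (intro P.indep_vars_edge_data[OF assms(8) _ K(1) _ _ assms(16,18,20)]) auto
  qed
  have indep_X: "P.indep_vars (\<lambda>_. borel) (edge_X M edge U V) K" if K: "K \<subseteq> {1..n}" "card K \<le> 3" for K
  proof -
    \<comment> \<open>Distinct edges use disjoint blocks of the data, so functions of the blocks are
      independent; \<open>?h k\<close> reads coordinate 2 to choose between the samples at 0 and
      1.\<close>
    let ?I = "\<lambda>k. {..<3::nat} \<times> {k}"
    let ?h = "\<lambda>k f. if f (2, k) = 0 then f (0, k) else f (1, k) :: real"
    have "P.indep_vars (\<lambda>k. PiM (?I k) (\<lambda>_. borel)) (\<lambda>k \<omega>. restrict (\<lambda>i. ?Y i \<omega>) (?I k)) K"
      by (rule P.indep_vars_restrict[OF data[OF K]]) (auto simp: disjoint_family_on_def)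
    moreover have "?h k \<in> borel_measurable (PiM (?I k) (\<lambda>_. borel))" for k
      by measurable
    ultimately have "P.indep_vars (\<lambda>_. borel) (\<lambda>k \<omega>. ?h k (restrict (\<lambda>i. ?Y i \<omega>) (?I k))) K"
      by (rule P.indep_vars_compose2)
    then show ?thesis
      by (rule P.indep_vars_cong[THEN iffD1, rotated -1]) (auto simp: edge_X_def fun_eq_iff)
  qed
  have law: "edge_X M edge U V k \<in> borel_measurable P \<and> distr P borel (edge_X M edge U V k) = F"
    if k: "k \<in> {1..n}" for k
  proof
    have dat: "P.indep_vars (\<lambda>_. borel) ?Y ({..<3::nat} \<times> {k})"
      using k by (intro data) auto
    show X: "edge_X M edge U V k \<in> borel_measurable P"
      using indep_X[of "{k}"] k by (auto simp: P.indep_vars_def)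
    have UV: "U k \<in> borel_measurable P" "V k \<in> borel_measurable P"
      using assms(16,18) k by (auto simp: P.indep_vars_def)
    have D: "(\<lambda>\<omega>. real (?D k \<omega>)) \<in> borel_measurable P"
    proof -
      have "\<forall>i\<in>{..<3} \<times> {k}. ?Y i \<in> borel_measurable P"
        using dat unfolding P.indep_vars_def by (rule conjunct1)
      from bspec[OF this, of "(2, k)"] show ?thesis by simp
    qed
    have D': "(\<lambda>\<omega>. real (?D k \<omega>)) -` {r} \<inter> space P \<in> sets P" for r
      using measurable_sets[OF D] by simp
    have D01: "?D k \<omega> = 0 \<or> ?D k \<omega> = 1" for \<omega>
      by (simp add: edge_indicator_def)
    have p1: "P.prob ((\<lambda>\<omega>. real (?D k \<omega>)) -` {1} \<inter> space P) = 1 / real l"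
    proof -
      \<comment> \<open>The one-edge case of the monochromatic probability supplies the mixing
        weight.\<close>
      have "edge k \<in> Es" using bij k by auto
      then have "P.prob {\<omega> \<in> space P. \<forall>e\<in>{edge k}. edge_indicator M e \<omega> = 1} =
          (1 / card {1..l}) ^ card {edge k}"
        by (intro P.prob_few_edges_monochromatic[OF assms(8,11) _ _ _ assms(14) R assms(15)]) auto
      moreover have "(\<lambda>\<omega>. real (?D k \<omega>)) -` {1} \<inter> space P =
          {\<omega> \<in> space P. \<forall>e\<in>{edge k}. edge_indicator M e \<omega> = 1}" by auto
      ultimately show ?thesis by simp
    qed
    have "(\<lambda>\<omega>. real (?D k \<omega>)) -` {0} \<inter> space P = space P - ((\<lambda>\<omega>. real (?D k \<omega>)) -` {1} \<inter> space P)"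
    proof (rule set_eqI)
      show "\<omega> \<in> (\<lambda>\<omega>. real (?D k \<omega>)) -` {0} \<inter> space P \<longleftrightarrow>
          \<omega> \<in> space P - ((\<lambda>\<omega>. real (?D k \<omega>)) -` {1} \<inter> space P)" for \<omega>
        using D01[of \<omega>] by (elim disjE) simp_all
    qed
    then have p0: "P.prob ((\<lambda>\<omega>. real (?D k \<omega>)) -` {0} \<inter> space P) = 1 - 1 / real l"
      using P.prob_compl[OF D'[of 1]] p1 by simp
    have sets_F: "sets F = sets borel"
      using assms(4) by auto
    have prob_F: "prob_space F"
      using N.prob_space_distr[OF assms(3)] assms(4) by simp
    have indep: "P.prob ((\<lambda>\<omega>. real (?D k \<omega>)) -` {r} \<inter> (?Y (t, k) -` B) \<inter> space P) =
        P.prob ((\<lambda>\<omega>. real (?D k \<omega>)) -` {r} \<inter> space P) * P.prob (?Y (t, k) -` B \<inter> space P)"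
      if "t \<in> {0, 1}" "B \<in> sets borel" for t B r
    proof -
      \<comment> \<open>The indicator, at first index 2, is tested against \<open>{r}\<close> and
        the sample against \<open>B\<close>; \<open>t \<in> {0, 1}\<close> keeps the two indices
        distinct.\<close>
      let ?A = "\<lambda>i. if fst i = 2 then {r} else B"
      have "P.prob (\<Inter>i\<in>{(2, k), (t, k)}. ?Y i -` ?A i \<inter> space P) =
          (\<Prod>i\<in>{(2, k), (t, k)}. P.prob (?Y i -` ?A i \<inter> space P))"
        using that by (intro P.indep_varsD[OF dat]) auto
      then show ?thesis
        using that by (auto simp: Int_ac)
    qed
    show "distr P borel (edge_X M edge U V k) = F"
    proof (rule measure_eqI)
      show "sets (distr P borel (edge_X M edge U V k)) = sets F"
        using sets_F by simp
      fix B assume "B \<in> sets (distr P borel (edge_X M edge U V k))"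
      then have B: "B \<in> sets borel" by simp
      have "edge_X M edge U V k -` B \<inter> space P =
          ((\<lambda>\<omega>. real (?D k \<omega>)) -` {0} \<inter> (?Y (0, k) -` B) \<inter> space P) \<union>
          ((\<lambda>\<omega>. real (?D k \<omega>)) -` {1} \<inter> (?Y (1, k) -` B) \<inter> space P)" (is "_ = ?E0 \<union> ?E1")
      proof (rule set_eqI)
        show "\<omega> \<in> edge_X M edge U V k -` B \<inter> space P \<longleftrightarrow> \<omega> \<in> ?E0 \<union> ?E1" for \<omega>
          using D01[of \<omega>] by (elim disjE) (simp_all add: edge_X_def)
      qed
      moreover have "?E0 = ((\<lambda>\<omega>. real (?D k \<omega>)) -` {0} \<inter> space P) \<inter> (U k -` B \<inter> space P)"
        "?E1 = ((\<lambda>\<omega>. real (?D k \<omega>)) -` {1} \<inter> space P) \<inter> (V k -` B \<inter> space P)"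
        by auto
      then have "?E0 \<in> sets P" "?E1 \<in> sets P"
        using D' measurable_sets[OF UV(1) B] measurable_sets[OF UV(2) B] by auto
      moreover have "?E0 \<inter> ?E1 = {}" by auto
      ultimately have "P.prob (edge_X M edge U V k -` B \<inter> space P) = P.prob ?E0 + P.prob ?E1"
        by (simp only: P.finite_measure_Union)
      also have "\<dots> = (1 - 1 / real l) * P.prob (U k -` B \<inter> space P) + 1 / real l * P.prob (V k -` B \<inter> space P)"
        using indep[of 0 B 0] indep[of 1 B 1] B p0 p1 by simp
      also have "\<dots> = (1 - 1 / real l) * measure (cond_law N W (- A)) B + 1 / real l * measure (cond_law N W A) B"
        using measure_distr[OF UV(1), of B] measure_distr[OF UV(2), of B] B assms(17,19)[OF k] by simp
      also have "\<dots> = measure (distr N borel W) B"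
        \<comment> \<open>\<open>l \<ge> 2\<close> places the weight \<open>1 / l\<close> strictly
          between 0 and 1.\<close>
        using assms(1) by (intro cond_law_mixture[OF assms(2,3,6) B assms(7)]) auto
      finally show "emeasure (distr P borel (edge_X M edge U V k)) B = emeasure F B"
        using X B assms(4) prob_F
        by (simp add: emeasure_distr P.emeasure_eq_measure
            finite_measure.emeasure_eq_measure[OF prob_space.finite_measure[OF prob_F]])
    qed
  qed
  show ?thesis
    using law indep_X by (auto simp: card_insert_if)
qed

end
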